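(* Let $s\in(0,1]$, let $\Phi_s:[0,\infty)\to[0,\infty)$ be an $s$-Young function, and let $\phi\in G_\phi$. Then the nonnegative function $\lVert\cdot\rVert_{\ell_{\phi,\Phi_s}}$ is a quasi-norm on the generalized discrete Orlicz-Morrey space $\ell_{\phi,\Phi_s}$.
   Context: Let $s\in(0,1]$. A function $\Phi_s:[0,\infty)\to\mathbb{R}$ is $s$-convex if $\Phi_s(ax+by)\le a^s\Phi_s(x)+b^s\Phi_s(y)$ for all $x,y\in[0,\infty)$ and all $a,b\in[0,\infty)$ with $a^s+b^s=1$. A function $\Phi_s:[0,\infty)\to[0,\infty)$ is an $s$-Young function if it is $s$-convex, continuous, $\Phi_s(0)=0$, and $\lim_{t\to\infty}\Phi_s(t)=\infty$. Let $\mathbb{N}_0=\mathbb{N}\cup\{0\}$. For $m\in\mathbb{Z}$ and $N\in\mathbb{N}_0$ put $S_{m,N}=\{m-N,\dots,m,\dots,m+N\}$, so $|S_{m,N}|=2N+1$. $G_\phi$ is the set of all functions $\phi:2\mathbb{N}_0+1\to(0,\infty)$ (defined on the odd positive integers) that are nondecreasing and such that $\frac{\phi(2N+1)}{2N+1}$ is nonincreasing in $N$. For a real sequence $x=(x_k)_{k\in\mathbb{Z}}$ define $$\lVert x\rVert_{\phi,\Phi_s,m,N}=\inf\Big\{b>0 \;\Big|\; \frac{\phi(2N+1)}{|S_{m,N}|}\sum_{k\in S_{m,N}}\Phi_s\Big(\frac{|x_k|}{b}\Big)\le 1\Big\},\qquad \lVert x\rVert_{\ell_{\phi,\Phi_s}}=\sup_{m\in\mathbb{Z},\,N\in\mathbb{N}_0}\lVert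 x\rVert_{\phi,\Phi_s,m,N}.$$ The generalized discrete Orlicz-Morrey space $\ell_{\phi,\Phi_s}$ is the set of all real sequences $x=(x_k)_{k\in\mathbb{Z}}$ with $\lVert x\rVert_{\ell_{\phi,\Phi_s}}<\infty$, with termwise operations. A function $\lVert\cdot\rVert:X\to[0,\infty)$ on a real vector space $X$ is a quasi-norm if for all $x,y\in X$ and $a\in\mathbb{R}$: (a) $\lVert x\rVert\ge 0$; (b) $\lVert x\rVert=0$ if and only if $x=0$; (c) $\lVert ax\rVert=|a|\lVert x\rVert$; and (d) there is a constant $C\ge 1$ (independent of $x,y$) such that $\lVert x+y\rVert\le C(\lVert x\rVert+\lVert y\rVert)$ for all $x,y\in X$. *)

theory Defs
  imports "HOL-Analysis.Analysis" "HOL-Library.Function_Algebras"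
begin

text \<open>Functions on \<open>[0,\<infinity>)\<close> are represented by total functions on \<open>real\<close>; only their
  values on \<open>{0..}\<close> are constrained. For \<open>s > 0\<close> and \<open>a \<ge> 0\<close>, \<open>a powr s\<close> is the usual
  power, including \<open>0 powr s = 0\<close>.\<close>

definition s_convex :: "real \<Rightarrow> (real \<Rightarrow> real) \<Rightarrow> bool" where
  "s_convex s \<Phi> \<longleftrightarrow>
     (\<forall>x\<ge>0. \<forall>y\<ge>0. \<forall>a\<ge>0. \<forall>b\<ge>0. a powr s + b powr s = 1 \<longrightarrow>
        \<Phi> (a * x + b * y) \<le> a powr s * \<Phi> x + b powr s * \<Phi> y)"

definition s_Young :: "real \<Rightarrow> (real \<Rightarrow> real) \<Rightarrow> bool" where
  "s_Young s \<Phi> \<longleftrightarrow>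
     (\<forall>t\<ge>0. 0 \<le> \<Phi> t) \<and> s_convex s \<Phi> \<and> continuous_on {0..} \<Phi> \<and> \<Phi> 0 = 0 \<and>
     filterlim \<Phi> at_top at_top"

definition window :: "int \<Rightarrow> nat \<Rightarrow> int set" where
  "window m N = {m - int N .. m + int N}"

text \<open>The weights are total functions on \<open>nat\<close>; only their values at odd arguments are
  constrained or used.\<close>

definition G_phi :: "(nat \<Rightarrow> real) set" where
  "G_phi = {\<phi>. (\<forall>n. odd n \<longrightarrow> 0 < \<phi> n) \<and> mono_on {n. odd n} \<phi> \<and>
                antimono (\<lambda>N. \<phi> (2 * N + 1) / real (2 * N + 1))}"

text \<open>The infimum and the supremum are taken in \<open>[0,\<infinity>]\<close>, so that the infimum of the empty
  set and an unbounded supremum are \<open>\<infinity>\<close>.\<close>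

definition local_norm ::
  "(nat \<Rightarrow> real) \<Rightarrow> (real \<Rightarrow> real) \<Rightarrow> int \<Rightarrow> nat \<Rightarrow> (int \<Rightarrow> real) \<Rightarrow> ennreal" where
  "local_norm \<phi> \<Phi> m N x =
     Inf {ennreal b | b. 0 < b \<and>
       \<phi> (2 * N + 1) / real (card (window m N)) * (\<Sum>k\<in>window m N. \<Phi> (\<bar>x k\<bar> / b)) \<le> 1}"

definition OM_norm ::
  "(nat \<Rightarrow> real) \<Rightarrow> (real \<Rightarrow> real) \<Rightarrow> (int \<Rightarrow> real) \<Rightarrow> ennreal" where
  "OM_norm \<phi> \<Phi> x = (SUP (m, N) \<in> UNIV. local_norm \<phi> \<Phi> m N x)"

definition OM_space :: "(nat \<Rightarrow> real) \<Rightarrow> (real \<Rightarrow> real) \<Rightarrow> (int \<Rightarrow> real) set" where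
  "OM_space \<phi> \<Phi> = {x. OM_norm \<phi> \<Phi> x < \<infinity>}"

text \<open>Termwise scaling of sequences; termwise addition and zero come from
  \<^theory>\<open>HOL-Library.Function_Algebras\<close>.\<close>

definition seq_scale :: "real \<Rightarrow> (int \<Rightarrow> real) \<Rightarrow> (int \<Rightarrow> real)" where
  "seq_scale a x = (\<lambda>k. a * x k)"

text \<open>\<open>nrm\<close> is a quasi-norm on the real vector space \<open>X\<close>, given as a linear subspace of an
  ambient real vector space with scalar multiplication \<open>scl\<close>.\<close>

definition quasi_norm_on ::
  "(real \<Rightarrow> 'v \<Rightarrow> 'v) \<Rightarrow> 'v::ab_group_add set \<Rightarrow> ('v \<Rightarrow> real) \<Rightarrow> bool" where
  "quasi_norm_on scl X nrm \<longleftrightarrow>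
     vector_space scl \<and> module.subspace scl X \<and>
     (\<forall>x\<in>X. 0 \<le> nrm x) \<and>
     (\<forall>x\<in>X. nrm x = 0 \<longleftrightarrow> x = 0) \<and>
     (\<forall>a. \<forall>x\<in>X. nrm (scl a x) = \<bar>a\<bar> * nrm x) \<and>
     (\<exists>C\<ge>1. \<forall>x\<in>X. \<forall>y\<in>X. nrm (x + y) \<le> C * (nrm x + nrm y))"

end

theory Submission
  imports Defs
begin

text \<open>Since \<open>\<Phi> 0 = 0\<close>, \<open>s\<close>-convexity makes \<open>\<Phi>\<close> nondecreasing, so the set of admissible \<open>b\<close> in the
  definition of the local norm is upward closed. Splitting \<open>(x + y) / (2 powr (1/s) * (b + c))\<close> with
  both coefficients equal to \<open>2 powr (-1/s)\<close> shows that \<open>2 powr (1/s) * (b + c)\<close> is admissible for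
  \<open>x + y\<close> whenever \<open>b\<close> and \<open>c\<close> are admissible for \<open>x\<close> and \<open>y\<close>; this gives the quasi-triangle
  inequality with constant \<open>2 powr (1/s)\<close>. Definiteness follows from the windows of size one,
  because \<open>\<Phi>\<close> is unbounded.\<close>

lemma s_Young_nonneg: "s_Young s \<Phi> \<Longrightarrow> 0 \<le> t \<Longrightarrow> 0 \<le> \<Phi> t"
  by (simp add: s_Young_def)

lemma s_Young_convexD:
  assumes "s_Young s \<Phi>" "a powr s + b powr s = 1" "0 \<le> x" "0 \<le> y" "0 \<le> a" "0 \<le> b"
  shows "\<Phi> (a * x + b * y) \<le> a powr s * \<Phi> x + b powr s * \<Phi> y"
  using assms unfolding s_Young_def s_convex_def by blast

text \<open>Write \<open>u = a * v + b * 0\<close> with \<open>a = u / v\<close> and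
  \<open>b\<close> solved from \<open>a powr s + b powr s = 1\<close>. The second term vanishes
  because \<open>\<Phi> 0 = 0\<close>, and \<open>a powr s \<le> 1\<close> bounds the first by
  \<open>\<Phi> v\<close>.\<close>

lemma s_Young_mono:
  assumes "0 < s" "s_Young s \<Phi>" "0 \<le> u" "u \<le> v"
  shows "\<Phi> u \<le> \<Phi> v"
proof (cases "u = v")
  case False
  define a where "a = u / v"
  define b where "b = (1 - a powr s) powr (1 / s)"
  have a: "0 \<le> a" "a \<le> 1" "u = a * v" "0 < v"
    using assms False by (auto simp: a_def)
  have a1: "a powr s \<le> 1"
    using a assms(1) by (simp add: powr_le1)
  have "a powr s + b powr s = 1"
    using a1 assms(1) by (simp add: b_def powr_powr)
  then have "\<Phi> (a * v + b * 0) \<le> a powr s * \<Phi> v + b powr s * \<Phi> 0"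
    using a by (intro s_Young_convexD[OF assms(2)]) (auto simp: b_def)
  also have "\<dots> = a powr s * \<Phi> v"
    using assms(2) by (simp add: s_Young_def)
  also have "\<dots> \<le> \<Phi> v"
    using a1 s_Young_nonneg[OF assms(2), of v] a(4) by (intro mult_left_le_one_le) auto
  finally show ?thesis
    using a(3) by simp
qed simp

lemma s_Young_half_sum:
  assumes "0 < s" "s_Young s \<Phi>" "0 \<le> u" "0 \<le> v"
  shows "\<Phi> ((u + v) / 2 powr (1 / s)) \<le> (\<Phi> u + \<Phi> v) / 2"
proof -
  \<comment> \<open>This is the common coefficient whose \<open>s\<close>-th power is 1/2, so two
    copies satisfy the constraint of \<open>s\<close>-convexity.\<close>
  define a :: real where "a = 1 / 2 powr (1 / s)"
  have a: "0 \<le> a" "a powr s = 1 / 2"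
    using assms(1) by (auto simp: a_def powr_divide powr_powr)
  have "\<Phi> (a * u + a * v) \<le> a powr s * \<Phi> u + a powr s * \<Phi> v"
    using assms(3,4) a by (intro s_Young_convexD[OF assms(2)]) auto
  then show ?thesis
    unfolding a(2) by (simp add: a_def add_divide_distrib)
qed

text \<open>Naming the condition under the infimum turns the local norm into an \<open>INF\<close>
  over a set, and scaling and addition can be studied on the level of single bounds
  \<open>b\<close>.\<close>

definition admissible ::
  "(nat \<Rightarrow> real) \<Rightarrow> (real \<Rightarrow> real) \<Rightarrow> int \<Rightarrow> nat \<Rightarrow> (int \<Rightarrow> real) \<Rightarrow> real \<Rightarrow> bool" where
  "admissible \<phi> \<Phi> m N x b \<longleftrightarrow>
     0 < b \<and> \<phi> (2 * N + 1) / real (card (window m N)) * (\<Sum>k\<in>window m N. \<Phi> (\<bar>x k\<bar> / b)) \<le> 1"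

lemma local_norm_eq_INF: "local_norm \<phi> \<Phi> m N x = (INF b\<in>Collect (admissible \<phi> \<Phi> m N x). ennreal b)"
  unfolding local_norm_def admissible_def by (rule arg_cong[of _ _ Inf]) auto

lemma weight_nonneg: "\<phi> \<in> G_phi \<Longrightarrow> 0 \<le> \<phi> (2 * N + 1) / real (card (window m N))"
  by (auto simp: G_phi_def less_imp_le)

text \<open>Every positive \<open>b\<close> is admissible for the zero sequence, but 0 is not; the
  infimum is therefore reached through arbitrarily small \<open>e\<close>.\<close>

lemma local_norm_zero:
  assumes "\<Phi> 0 = 0"
  shows "local_norm \<phi> \<Phi> m N 0 = 0"
proof -
  have "local_norm \<phi> \<Phi> m N 0 \<le> 0"
  proof (rule ennreal_le_epsilon)
    fix e :: real assume "0 < e"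
    then show "local_norm \<phi> \<Phi> m N 0 \<le> 0 + ennreal e"
      unfolding local_norm_eq_INF using assms by (auto intro!: INF_lower simp: admissible_def)
  qed
  then show ?thesis by simp
qed

lemma admissible_seq_scale:
  assumes "a \<noteq> 0"
  shows "admissible \<phi> \<Phi> m N (seq_scale a x) (\<bar>a\<bar> * b) \<longleftrightarrow> admissible \<phi> \<Phi> m N x b"
  using assms by (simp add: admissible_def seq_scale_def abs_mult zero_less_mult_iff)

text \<open>Dividing a bound for the scaled sequence by \<open>\<bar>a\<bar>\<close> gives a bound
  for \<open>x\<close>. The opposite inequality comes later from the factor
  \<open>1 / a\<close>.\<close>

lemma local_norm_seq_scale_ge:
  assumes "a \<noteq> 0"
  shows "ennreal \<bar>a\<bar> * local_norm \<phi> \<Phi> m N x \<le> local_norm \<phi> \<Phi> m N (seq_scale a x)"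
  unfolding local_norm_eq_INF[of _ _ _ _ "seq_scale a x"]
proof (rule INF_greatest)
  fix b assume b: "b \<in> Collect (admissible \<phi> \<Phi> m N (seq_scale a x))"
  have "admissible \<phi> \<Phi> m N x (b / \<bar>a\<bar>)"
    using b assms admissible_seq_scale[OF assms, of \<phi> \<Phi> m N x "b / \<bar>a\<bar>"] by simp
  then have "local_norm \<phi> \<Phi> m N x \<le> ennreal (b / \<bar>a\<bar>)"
    unfolding local_norm_eq_INF by (intro INF_lower) simp
  then have "ennreal \<bar>a\<bar> * local_norm \<phi> \<Phi> m N x \<le> ennreal \<bar>a\<bar> * ennreal (b / \<bar>a\<bar>)"
    by (intro mult_left_mono) auto
  also have "\<dots> = ennreal b"
    using assms by (simp add: ennreal_mult'[symmetric])
  finally show "ennreal \<bar>a\<bar> * local_norm \<phi> \<Phi> m N x \<le> ennreal b" .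
qed

lemma OM_norm_seq_scale:
  assumes "\<Phi> 0 = 0"
  shows "OM_norm \<phi> \<Phi> (seq_scale a x) = ennreal \<bar>a\<bar> * OM_norm \<phi> \<Phi> x"
proof (cases "a = 0")
  \<comment> \<open>The convention that 0 times infinity is 0 in \<open>ennreal\<close> makes the
    formula hold even when \<open>x\<close> has infinite norm.\<close>
  case True
  then have "seq_scale a x = 0" by (auto simp: seq_scale_def)
  then show ?thesis
    using True assms by (auto simp: OM_norm_def local_norm_zero)
next
  case False
  have ge: "ennreal \<bar>c\<bar> * OM_norm \<phi> \<Phi> y \<le> OM_norm \<phi> \<Phi> (seq_scale c y)" if "c \<noteq> 0" for c y
    unfolding OM_norm_def SUP_mult_left_ennreal
    using local_norm_seq_scale_ge[OF that] by (intro SUP_mono) fastforce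
  \<comment> \<open>For the reverse inequality, \<open>ge\<close> is applied to the factor
    \<open>1 / a\<close> and the sequence \<open>seq_scale a x\<close>.\<close>
  have "OM_norm \<phi> \<Phi> (seq_scale a x)
      = ennreal \<bar>a\<bar> * (ennreal \<bar>1 / a\<bar> * OM_norm \<phi> \<Phi> (seq_scale a x))"
    using False by (simp add: mult.assoc[symmetric] ennreal_mult[symmetric])
  also have "\<dots> \<le> ennreal \<bar>a\<bar> * OM_norm \<phi> \<Phi> (seq_scale (1 / a) (seq_scale a x))"
    using ge[of "1 / a" "seq_scale a x"] False by (intro mult_left_mono) auto
  also have "seq_scale (1 / a) (seq_scale a x) = x"
    using False by (simp add: seq_scale_def)
  finally show ?thesis
    using ge[OF False] by (intro antisym)
qed

text \<open>Some admissible \<open>c\<close> lies below \<open>b\<close>, and passing from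
  \<open>c\<close> to \<open>b\<close> shrinks every argument of the nondecreasing
  \<open>\<Phi>\<close>.\<close>

lemma admissible_of_local_norm_less:
  assumes "0 < s" "s_Young s \<Phi>" "\<phi> \<in> G_phi" "local_norm \<phi> \<Phi> m N x < ennreal b"
  shows "admissible \<phi> \<Phi> m N x b"
proof -
  obtain c where c: "admissible \<phi> \<Phi> m N x c" "ennreal c < ennreal b"
    using assms(4) unfolding local_norm_eq_INF by (auto simp: INF_less_iff)
  have cb: "0 < c" "c < b"
    using c by (auto simp: admissible_def ennreal_less_iff)
  have "\<phi> (2 * N + 1) / real (card (window m N)) * (\<Sum>k\<in>window m N. \<Phi> (\<bar>x k\<bar> / b))
      \<le> \<phi> (2 * N + 1) / real (card (window m N)) * (\<Sum>k\<in>window m N. \<Phi> (\<bar>x k\<bar> / c))"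
    using cb by (intro mult_left_mono[OF _ weight_nonneg[OF assms(3)]] sum_mono
        s_Young_mono[OF assms(1,2)] frac_le) auto
  then show ?thesis
    using c cb by (auto simp: admissible_def)
qed

lemma admissible_add:
  assumes "0 < s" "s_Young s \<Phi>" "\<phi> \<in> G_phi"
    and x: "admissible \<phi> \<Phi> m N x b" and y: "admissible \<phi> \<Phi> m N y c"
  shows "admissible \<phi> \<Phi> m N (x + y) (2 powr (1 / s) * (b + c))"
proof -
  have pos: "0 < b" "0 < c"
    using x y by (auto simp: admissible_def)
  define w where "w = \<phi> (2 * N + 1) / real (card (window m N))"
  have pointwise: "\<Phi> (\<bar>(x + y) k\<bar> / (2 powr (1 / s) * (b + c))) \<le> (\<Phi> (\<bar>x k\<bar> / b) + \<Phi> (\<bar>y k\<bar> / c)) / 2" for k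
  proof -
    have "\<bar>(x + y) k\<bar> / (2 powr (1 / s) * (b + c)) = (\<bar>x k + y k\<bar> / (b + c)) / 2 powr (1 / s)"
      by simp
    also have "\<dots> \<le> (\<bar>x k\<bar> / b + \<bar>y k\<bar> / c) / 2 powr (1 / s)"
    proof (rule divide_right_mono)
      have "\<bar>x k + y k\<bar> / (b + c) \<le> (\<bar>x k\<bar> + \<bar>y k\<bar>) / (b + c)"
        using pos by (intro divide_right_mono) auto
      \<comment> \<open>Each summand only grows when its denominator \<open>b + c\<close> drops to
        \<open>b\<close> or \<open>c\<close>.\<close>
      also have "\<dots> \<le> \<bar>x k\<bar> / b + \<bar>y k\<bar> / c"
        unfolding add_divide_distrib using pos by (intro add_mono frac_le) auto
      finally show "\<bar>x k + y k\<bar> / (b + c) \<le> \<bar>x k\<bar> / b + \<bar>y k\<bar> / c" .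
    qed simp
    finally have "\<Phi> (\<bar>(x + y) k\<bar> / (2 powr (1 / s) * (b + c)))
        \<le> \<Phi> ((\<bar>x k\<bar> / b + \<bar>y k\<bar> / c) / 2 powr (1 / s))"
      using pos by (intro s_Young_mono[OF assms(1,2)]) auto
    also have "\<dots> \<le> (\<Phi> (\<bar>x k\<bar> / b) + \<Phi> (\<bar>y k\<bar> / c)) / 2"
      using pos by (intro s_Young_half_sum[OF assms(1,2)]) auto
    finally show ?thesis .
  qed
  have "w * (\<Sum>k\<in>window m N. \<Phi> (\<bar>(x + y) k\<bar> / (2 powr (1 / s) * (b + c))))
      \<le> w * (\<Sum>k\<in>window m N. (\<Phi> (\<bar>x k\<bar> / b) + \<Phi> (\<bar>y k\<bar> / c)) / 2)"
    using pointwise unfolding w_def by (intro mult_left_mono[OF _ weight_nonneg[OF assms(3)]] sum_mono)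
  also have "\<dots> = (w * (\<Sum>k\<in>window m N. \<Phi> (\<bar>x k\<bar> / b)) + w * (\<Sum>k\<in>window m N. \<Phi> (\<bar>y k\<bar> / c))) / 2"
    by (simp add: sum.distrib sum_divide_distrib[symmetric] distrib_left)
  also have "\<dots> \<le> 1"
    using x y by (auto simp: admissible_def w_def)
  finally show ?thesis
    using pos by (simp add: admissible_def w_def)
qed

text \<open>With a finite real on the right, the one estimate yields both closure of the space under
  addition and the quasi-triangle inequality.\<close>

lemma OM_norm_add_le:
  assumes "0 < s" "s_Young s \<Phi>" "\<phi> \<in> G_phi"
    and x: "x \<in> OM_space \<phi> \<Phi>" and y: "y \<in> OM_space \<phi> \<Phi>"
  shows "OM_norm \<phi> \<Phi> (x + y)
    \<le> ennreal (2 powr (1 / s) * (enn2real (OM_norm \<phi> \<Phi> x) + enn2real (OM_norm \<phi> \<Phi> y)))"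
proof (rule ennreal_le_epsilon)
  fix e :: real assume e: "0 < e"
  define C :: real where "C = 2 powr (1 / s)"
  have C: "0 < C" by (simp add: C_def)
  \<comment> \<open>The slack puts \<open>b z\<close> strictly above the norm, hence makes it
    admissible for all windows at once; two slacks multiplied by \<open>C\<close> add up to
    \<open>e\<close>.\<close>
  define b where "b z = enn2real (OM_norm \<phi> \<Phi> z) + e / (2 * C)" for z
  have adm: "admissible \<phi> \<Phi> m N z (b z)" if "z \<in> OM_space \<phi> \<Phi>" for z m N
  proof (rule admissible_of_local_norm_less[OF assms(1-3)])
    have "local_norm \<phi> \<Phi> m N z \<le> OM_norm \<phi> \<Phi> z"
      unfolding OM_norm_def by (rule SUP_upper2[of "(m, N)"]) auto
    also have "\<dots> = ennreal (enn2real (OM_norm \<phi> \<Phi> z))"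
      using that by (simp add: OM_space_def)
    also have "\<dots> < ennreal (b z)"
      using e C by (intro ennreal_lessI) (auto simp: b_def add_nonneg_pos)
    finally show "local_norm \<phi> \<Phi> m N z < ennreal (b z)" .
  qed
  have "OM_norm \<phi> \<Phi> (x + y) \<le> ennreal (C * (b x + b y))"
    unfolding OM_norm_def local_norm_eq_INF C_def
    using admissible_add[OF assms(1-3) adm[OF x] adm[OF y]]
    by (auto intro!: SUP_least INF_lower)
  also have "\<dots> = ennreal (C * (enn2real (OM_norm \<phi> \<Phi> x) + enn2real (OM_norm \<phi> \<Phi> y)) + e)"
    using C by (intro arg_cong[of _ _ ennreal]) (simp add: b_def field_simps)
  also have "\<dots> = ennreal (C * (enn2real (OM_norm \<phi> \<Phi> x) + enn2real (OM_norm \<phi> \<Phi> y))) + ennreal e"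
    using C e by (intro ennreal_plus) auto
  finally show "OM_norm \<phi> \<Phi> (x + y)
      \<le> ennreal (2 powr (1 / s) * (enn2real (OM_norm \<phi> \<Phi> x) + enn2real (OM_norm \<phi> \<Phi> y))) + ennreal e"
    unfolding C_def .
qed

lemma OM_norm_eq_0_imp:
  assumes "0 < s" "s_Young s \<Phi>" "\<phi> \<in> G_phi" "OM_norm \<phi> \<Phi> x = 0"
  shows "x = 0"
proof (rule ext, rule ccontr)
  fix k assume "x k \<noteq> 0 k"
  then have xk: "x k \<noteq> 0" by simp
  have \<phi>1: "0 < \<phi> 1"
    using assms(3) by (simp add: G_phi_def)
  \<comment> \<open>The window of size one at \<open>k\<close> carries the weight
    \<open>\<phi> 1\<close>, so such a \<open>t\<close> violates its constraint.\<close>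
  have "eventually (\<lambda>t. 1 / \<phi> 1 < \<Phi> t \<and> 0 < t) at_top"
    using assms(2) eventually_gt_at_top[of 0]
    by (auto simp: s_Young_def filterlim_at_top_dense intro: eventually_conj)
  then obtain t where t: "1 / \<phi> 1 < \<Phi> t" "0 < t"
    using eventually_happens'[OF trivial_limit_at_top_linorder] by blast
  \<comment> \<open>Chosen so that \<open>\<bar>x k\<bar> / b = t\<close>.\<close>
  define b where "b = \<bar>x k\<bar> / t"
  have b: "0 < b" using xk t by (simp add: b_def)
  have "local_norm \<phi> \<Phi> k 0 x \<le> OM_norm \<phi> \<Phi> x"
    unfolding OM_norm_def by (rule SUP_upper2[of "(k, 0)"]) auto
  then have "local_norm \<phi> \<Phi> k 0 x < ennreal b"
    using assms(4) b by simp
  then have "admissible \<phi> \<Phi> k 0 x b"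
    by (rule admissible_of_local_norm_less[OF assms(1-3)])
  then have "\<phi> 1 * \<Phi> t \<le> 1"
    using xk t by (simp add: admissible_def window_def b_def)
  then show False
    using t \<phi>1 by (simp add: field_simps)
qed

theorem theorem3p7:
  fixes s :: real and \<Phi> :: "real \<Rightarrow> real" and \<phi> :: "nat \<Rightarrow> real"
  assumes "0 < s" and "s \<le> 1"
    and "s_Young s \<Phi>"
    and "\<phi> \<in> G_phi"
  shows "quasi_norm_on seq_scale (OM_space \<phi> \<Phi>) (\<lambda>x. enn2real (OM_norm \<phi> \<Phi> x))"
proof -
  let ?X = "OM_space \<phi> \<Phi>" and ?n = "\<lambda>x. enn2real (OM_norm \<phi> \<Phi> x)"
  let ?C = "2 powr (1 / s)"
  note add_le = OM_norm_add_le[OF assms(1,3,4)]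
  have scale: "OM_norm \<phi> \<Phi> (seq_scale a x) = ennreal \<bar>a\<bar> * OM_norm \<phi> \<Phi> x" for a x
    using assms(3) by (intro OM_norm_seq_scale) (simp add: s_Young_def)
  have zero: "OM_norm \<phi> \<Phi> 0 = 0"
    using scale[of 0 0] by (simp add: seq_scale_def zero_fun_def)
  have vs: "vector_space seq_scale"
    by unfold_locales (auto simp: seq_scale_def algebra_simps)
  then interpret vector_space seq_scale .
  have sub: "subspace ?X"
  proof (rule subspaceI)
    show "0 \<in> ?X"
      by (simp add: OM_space_def zero)
    show "x + y \<in> ?X" if "x \<in> ?X" "y \<in> ?X" for x y
      using le_less_trans[OF add_le[OF that] ennreal_less_top] by (simp add: OM_space_def)
    show "seq_scale c x \<in> ?X" if "x \<in> ?X" for c x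
      using that by (simp add: OM_space_def scale ennreal_mult_less_top)
  qed
  \<comment> \<open>Since \<open>enn2real\<close> also sends infinity to 0, finiteness of the norm
    on the space is what excludes a spurious zero.\<close>
  have def0: "?n x = 0 \<longleftrightarrow> x = 0" if "x \<in> ?X" for x
    using that zero OM_norm_eq_0_imp[OF assms(1,3,4), of x]
    by (auto simp: OM_space_def enn2real_eq_0_iff)
  have tri: "?n (x + y) \<le> ?C * (?n x + ?n y)" if "x \<in> ?X" "y \<in> ?X" for x y
    using enn2real_mono[OF add_le[OF that]] by simp
  have "1 \<le> ?C"
    using assms(1) by (simp add: ge_one_powr_ge_zero)
  then show ?thesis
    unfolding quasi_norm_on_def using vs sub def0 tri
    by (auto simp: scale enn2real_mult)
qed

end
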